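(* Let $f:\mathbb{R}^d\to\mathbb{R}\cup\{\infty\}$ be convex and $\ell$-smooth, attaining its minimum at $x^*\in\mathbb{R}^d$, and let $x^0\in\mathcal{X}$. Suppose that $\psi:\mathbb{R}_+\to\mathbb{R}_+$, $\psi(x)=\frac{x^2}{2\ell(4x)}$, is strictly increasing. Let $\delta\in(0,\infty)$ be any number such that $\ell\left(8\sqrt{\delta\,\ell(0)}\right)\le 2\ell(0)$, and let $\bar R>0$ be any number with $\bar R\ge R:=\|x^0-x^*\|$. Then Algorithm 1 run from $x^0$ with parameters $\delta$ and $\bar R$ guarantees that $$f(y^{k+1})-f(x^* )\le \Gamma_{k+1}\bar R^2\le \frac{18\,\ell(0)\,\bar R^2}{(k+1-\bar k)^2}$$ for all integers $k\ge \bar k:=\max\left\{1+\frac12\log_{3/2}\left(\frac{\Gamma_0}{8\ell(0)}\right),0\right\}$.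
   Context: $\|\cdot\|$ is the Euclidean norm for vectors and the spectral norm for matrices; $\mathbb{R}_+=[0,\infty)$. Setting: $f:\mathbb{R}^d\to\mathbb{R}\cup\{\infty\}$, $\mathcal{X}:=\{x\in\mathbb{R}^d: f(x)<\infty\}$ is assumed to be an open, $d$-dimensional (nonempty) convex set, and $\bar{\mathcal{X}}$ denotes its closure; $\mathrm{Proj}_{\bar{\mathcal{X}}}$ is the Euclidean projection onto $\bar{\mathcal{X}}$. $f$ is $\ell$-smooth if $f$ is twice differentiable on $\mathcal{X}$, continuous on $\bar{\mathcal{X}}$, and $\ell:[0,\infty)\to(0,\infty)$ is a non-decreasing, positive, locally Lipschitz function with $\|\nabla^2 f(x)\|\le \ell(\|\nabla f(x)\|)$ for all $x\in\mathcal{X}$. Algorithm 1 (input: $x^0\in\mathcal{X}$, $\ell$, $\delta$, $\bar R$). Phase 1: starting from $x^0$, run gradient descent (GD) $x^{j+1}=x^j-\eta_j\nabla f(x^j)$ with $\eta_j=\int_0^1\frac{dv}{\ell(\|\nabla f(x^j)\|+\|\nabla f(x^j)\|v)}$ until a point $\bar x$ with $f(\bar x)-f(x^* )\le\delta/2$ is reached. Phase 2: set $y^0=u^0=\bar x$, $\Gamma_0=\delta/\bar R^2$, $\gamma=1/(2\ell(0))$, and for $k=0,1,2,\dots$: $\alpha_k=\sqrt{\gamma\Gamma_k}$; $y^{k+1}=\frac{1}{1+\alpha_k}y^k+\frac{\alpha_k}{1+\alpha_k}u^k-\frac{\gamma}{1+\alpha_k}\nabla f(y^k)$; $u^{k+1}=\mathrm{Proj}_{\bar{\mathcal{X}}}\left(u^k-\frac{\alpha_k}{\Gamma_k}\nabla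 f(y^{k+1})\right)$; $\Gamma_{k+1}=\Gamma_k/(1+\alpha_k)$. *)

theory Defs
  imports "HOL-Analysis.Analysis"
begin

text \<open>
  Functions into the reals extended by plus infinity are functions into \<^typ>\<open>ereal\<close> that do not
  take the value minus infinity.
\<close>

definition eff_dom :: "('a \<Rightarrow> ereal) \<Rightarrow> 'a set" where
  "eff_dom f = {x. f x < \<infinity>}"

text \<open>On \<^typ>\<open>ereal\<close> we have \<open>0 * \<infinity> = 0\<close>, so the endpoints \<open>t = 0\<close> and \<open>t = 1\<close> cause no trouble.\<close>

definition ereal_convex :: "('a::real_vector \<Rightarrow> ereal) \<Rightarrow> bool" where
  "ereal_convex f \<longleftrightarrow>
     (\<forall>x y. \<forall>t\<in>{0..1}.
        f ((1 - t) *\<^sub>R x + t *\<^sub>R y) \<le> ereal (1 - t) * f x + ereal t * f y)"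

definition grad :: "('a::real_inner \<Rightarrow> ereal) \<Rightarrow> 'a \<Rightarrow> 'a" where
  "grad f x = (THE D. GDERIV (\<lambda>z. real_of_ereal (f z)) x :> D)"

text \<open>The Hessian as a linear map; its spectral norm is its operator norm \<^const>\<open>onorm\<close>.\<close>

definition hess :: "('a::real_inner \<Rightarrow> ereal) \<Rightarrow> 'a \<Rightarrow> 'a \<Rightarrow> 'a" where
  "hess f x = frechet_derivative (grad f) (at x)"

text \<open>
  Continuity on the closure of the domain is continuity of the extended-valued function: since the
  domain is open in the intended setting, \<open>f\<close> is infinite on its boundary and hence tends to
  infinity there. The function \<open>l\<close> is only constrained on the nonnegative reals, which is also
  the only place where it is evaluated. The first argument of \<^const>\<open>local_lipschitz\<close> is a
  parameter on which \<open>l\<close> does not depend.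
\<close>

definition l_smooth :: "(real \<Rightarrow> real) \<Rightarrow> ('a::euclidean_space \<Rightarrow> ereal) \<Rightarrow> bool" where
  "l_smooth l f \<longleftrightarrow>
     (\<forall>x\<in>eff_dom f. (\<lambda>z. real_of_ereal (f z)) differentiable (at x)) \<and>
     (\<forall>x\<in>eff_dom f. grad f differentiable (at x)) \<and>
     continuous_on (closure (eff_dom f)) f \<and>
     mono_on {0..} l \<and> (\<forall>s\<ge>0. l s > 0) \<and>
     local_lipschitz (UNIV :: real set) {0..} (\<lambda>_. l) \<and>
     (\<forall>x\<in>eff_dom f. onorm (hess f x) \<le> l (norm (grad f x)))"

definition gd_step_size ::
  "(real \<Rightarrow> real) \<Rightarrow> ('a::euclidean_space \<Rightarrow> ereal) \<Rightarrow> 'a \<Rightarrow> real" where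
  "gd_step_size l f x =
     integral {0..1} (\<lambda>v. 1 / l (norm (grad f x) + norm (grad f x) * v))"

primrec gd_iter ::
  "(real \<Rightarrow> real) \<Rightarrow> ('a::euclidean_space \<Rightarrow> ereal) \<Rightarrow> 'a \<Rightarrow> nat \<Rightarrow> 'a" where
  "gd_iter l f x0 0 = x0"
| "gd_iter l f x0 (Suc j) =
     gd_iter l f x0 j - gd_step_size l f (gd_iter l f x0 j) *\<^sub>R grad f (gd_iter l f x0 j)"

text \<open>
  Phase 1 stops at the first gradient descent iterate within \<open>\<delta> / 2\<close> of the minimal
  value; \<open>xs\<close> is a minimizer of \<open>f\<close>.
\<close>

definition gd_stop ::
  "(real \<Rightarrow> real) \<Rightarrow> ('a::euclidean_space \<Rightarrow> ereal) \<Rightarrow> 'a \<Rightarrow> real \<Rightarrow> 'a \<Rightarrow> nat \<Rightarrow> bool" where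
  "gd_stop l f xs \<delta> x0 j \<longleftrightarrow> f (gd_iter l f x0 j) - f xs \<le> ereal (\<delta> / 2)"

definition phase1_output ::
  "(real \<Rightarrow> real) \<Rightarrow> ('a::euclidean_space \<Rightarrow> ereal) \<Rightarrow> 'a \<Rightarrow> real \<Rightarrow> 'a \<Rightarrow> 'a" where
  "phase1_output l f xs \<delta> x0 = gd_iter l f x0 (LEAST j. gd_stop l f xs \<delta> x0 j)"

definition alg_gamma :: "(real \<Rightarrow> real) \<Rightarrow> real" where
  "alg_gamma l = 1 / (2 * l 0)"

primrec alg_Gamma :: "(real \<Rightarrow> real) \<Rightarrow> real \<Rightarrow> real \<Rightarrow> nat \<Rightarrow> real" where
  "alg_Gamma l \<delta> Rbar 0 = \<delta> / Rbar\<^sup>2"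
| "alg_Gamma l \<delta> Rbar (Suc k) =
     alg_Gamma l \<delta> Rbar k / (1 + sqrt (alg_gamma l * alg_Gamma l \<delta> Rbar k))"

definition alg_alpha :: "(real \<Rightarrow> real) \<Rightarrow> real \<Rightarrow> real \<Rightarrow> nat \<Rightarrow> real" where
  "alg_alpha l \<delta> Rbar k = sqrt (alg_gamma l * alg_Gamma l \<delta> Rbar k)"

text \<open>The pair \<open>(y, u)\<close> of Phase 2 iterates, started from the point \<open>xbar\<close>.\<close>

primrec phase2_iter ::
  "(real \<Rightarrow> real) \<Rightarrow> ('a::euclidean_space \<Rightarrow> ereal) \<Rightarrow> real \<Rightarrow> real \<Rightarrow> 'a \<Rightarrow> nat \<Rightarrow> 'a \<times> 'a" where
  "phase2_iter l f \<delta> Rbar xbar 0 = (xbar, xbar)"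
| "phase2_iter l f \<delta> Rbar xbar (Suc k) =
     (let (y, u) = phase2_iter l f \<delta> Rbar xbar k;
          \<alpha> = alg_alpha l \<delta> Rbar k;
          y' = (1 / (1 + \<alpha>)) *\<^sub>R y + (\<alpha> / (1 + \<alpha>)) *\<^sub>R u
                 - (alg_gamma l / (1 + \<alpha>)) *\<^sub>R grad f y;
          u' = closest_point (closure (eff_dom f))
                 (u - (\<alpha> / alg_Gamma l \<delta> Rbar k) *\<^sub>R grad f y')
      in (y', u'))"

definition alg_y ::
  "(real \<Rightarrow> real) \<Rightarrow> ('a::euclidean_space \<Rightarrow> ereal) \<Rightarrow> 'a \<Rightarrow> real \<Rightarrow> real \<Rightarrow> 'a \<Rightarrow> nat \<Rightarrow> 'a" where
  "alg_y l f xs \<delta> Rbar x0 k = fst (phase2_iter l f \<delta> Rbar (phase1_output l f xs \<delta> x0) k)"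

end

theory Submission
  imports Defs
begin

text \<open>
  The basic estimate is local: if \<open>norm (grad f x) \<le> a\<close> and \<open>l (a + s) * norm d \<le> s\<close>, then the
  segment from \<open>x\<close> to \<open>x + d\<close> stays in the domain and the gradient changes by at most \<open>s\<close> along
  it, so \<open>f\<close> behaves there like an \<open>l (a + s)\<close>-smooth function. Chaining such steps yields the same
  for displacements up to the integral that defines the step size of gradient descent; hence
  gradient descent never increases the distance to the minimizer, and the gap falls by at
  least \<open>\<psi> (norm (grad f x))\<close> per step, where \<open>\<psi> s = s\<^sup>2 / (2 * l (4 * s))\<close>.

  In the second phase let \<open>D = sqrt (\<delta> * l 0)\<close>. The Lyapunov function
  \<open>f y - f xs + \<Gamma> / 2 * (norm (u - xs))\<^sup>2\<close> stays below \<open>\<Gamma> * Rbar\<^sup>2 \<le> \<delta>\<close>. Since \<open>\<psi>\<close> is increasing, this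
  bounds the gradient at \<open>y\<close> by \<open>2 * D\<close>; moreover \<open>y\<close> and \<open>u\<close> stay within \<open>sqrt 2 * Rbar\<close> of
  the minimizer, so one step moves \<open>y\<close> by at most \<open>3 * D / l 0\<close>. On this scale the gradient is at most
  \<open>8 * D\<close> and \<open>f\<close> is \<open>2 * l 0\<close>-smooth by the choice of \<open>\<delta>\<close>, so the classical accelerated descent argument
  applies.
\<close>

section \<open>Intervals, integrals and a recursion\<close>

text \<open>Real induction: \<open>limit\<close> carries \<open>P\<close> to the supremum of the
  initial segments where it holds, and \<open>extend\<close> leads past that supremum unless it is
  1. It serves to propagate membership in the domain together with a gradient bound along a
  path.\<close>

lemma real_unit_interval_induct:
  fixes P :: "real \<Rightarrow> bool"
  assumes start: "P 0"
    and limit: "\<And>t. \<lbrakk>0 < t; t \<le> 1; \<And>r. \<lbrakk>0 \<le> r; r < t\<rbrakk> \<Longrightarrow> P r\<rbrakk> \<Longrightarrow> P t"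
    and extend: "\<And>t. \<lbrakk>0 \<le> t; t < 1; \<And>r. \<lbrakk>0 \<le> r; r \<le> t\<rbrakk> \<Longrightarrow> P r\<rbrakk>
                   \<Longrightarrow> \<exists>e>0. \<forall>r. t < r \<and> r < t + e \<longrightarrow> P r"
    and t: "0 \<le> t" "t \<le> 1"
  shows "P t"
proof -
  define A where "A = {t. 0 \<le> t \<and> t \<le> 1 \<and> (\<forall>r. 0 \<le> r \<and> r \<le> t \<longrightarrow> P r)}"
  define T where "T = Sup A"
  have "0 \<in> A"
    using start by (auto simp: A_def)
  have bdd: "bdd_above A"
    by (auto simp: A_def bdd_above_def)
  have T: "0 \<le> T" "T \<le> 1"
    unfolding T_def
    using cSup_upper[OF \<open>0 \<in> A\<close> bdd] \<open>0 \<in> A\<close> by (auto intro!: cSup_least simp: A_def)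
  have below: "P r" if r: "0 \<le> r" "r < T" for r
  proof -
    obtain s where "s \<in> A" "r < s"
      using r(2) less_cSup_iff[OF _ bdd] \<open>0 \<in> A\<close> unfolding T_def by blast
    then show ?thesis
      using r(1) by (auto simp: A_def)
  qed
  have "P T"
    using start limit[of T] below T by (cases "T = 0") auto
  then have upto: "P r" if "0 \<le> r" "r \<le> T" for r
    using below that by (cases "r = T") auto
  have "T = 1"
  proof (rule ccontr)
    assume "T \<noteq> 1"
    then obtain e where e: "e > 0" "\<And>r. T < r \<Longrightarrow> r < T + e \<Longrightarrow> P r"
      using extend[of T] T upto by force
    define s where "s = min 1 (T + e / 2)"
    have "T < s" "s < T + e" "s \<le> 1"
      using \<open>T \<noteq> 1\<close> T e(1) by (auto simp: s_def)
    then have "s \<in> A"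
      using T upto e(2) by (fastforce simp: A_def not_le)
    then show False
      using cSup_upper[OF _ bdd] \<open>T < s\<close> unfolding T_def by fastforce
  qed
  then show ?thesis
    using upto t by auto
qed

section \<open>Integrals and Riemann sums of nonincreasing functions\<close>

lemma integrable_on_antimono_on:
  fixes \<phi> :: "real \<Rightarrow> real"
  assumes "antimono_on {a..b} \<phi>"
  shows "\<phi> integrable_on {a..b}"
proof -
  have "mono_on {a..b} (\<lambda>x. - \<phi> x)"
    using assms by (auto simp: monotone_on_def)
  then have "(\<lambda>x. - \<phi> x) integrable_on {a..b}"
    by (rule integrable_on_mono_on)
  from integrable_neg[OF this] show ?thesis
    by simp
qed

text \<open>On each cell the integral is at most the left-endpoint value over \<open>n\<close>, and
  left and right sums differ by a telescoping sum. Right endpoints are kept because they are the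
  arguments of \<open>l\<close> that occur when local gradient steps are chained.\<close>

lemma integral_antimono_le_right_sum:
  fixes \<phi> :: "real \<Rightarrow> real"
  assumes \<phi>: "antimono_on {0..1} \<phi>" and n: "0 < n"
  shows "integral {0..1} \<phi> \<le> (\<Sum>j<n. \<phi> (real (Suc j) / n) / n) + (\<phi> 0 - \<phi> 1) / n"
proof -
  note int = integrable_on_antimono_on[OF \<phi>]
  have "integral {0..real i / n} \<phi> \<le> (\<Sum>j<i. \<phi> (real (Suc j) / n) / n) + (\<phi> 0 - \<phi> (real i / n)) / n"
    if "i \<le> n" for i
    using that
  proof (induction i)
    case (Suc i)
    let ?a = "real i / n" and ?b = "real (Suc i) / n"
    have le: "0 \<le> ?a" "?a \<le> ?b" "?b \<le> 1"
      using Suc.prems n by (auto simp: field_simps)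
    have intb: "\<phi> integrable_on {0..?b}"
      by (rule integrable_subinterval_real[OF int]) (use le in auto)
    have intc: "\<phi> integrable_on {?a..?b}"
      by (rule integrable_subinterval_real[OF int]) (use le in auto)
    have "integral {?a..?b} \<phi> \<le> integral {?a..?b} (\<lambda>_. \<phi> ?a)"
    proof (rule integral_le[OF intc])
      fix x assume "x \<in> {?a..?b}"
      then show "\<phi> x \<le> \<phi> ?a"
        using le order_trans[OF le(1), of x] by (intro monotone_onD[OF \<phi>]) auto
    qed (rule integrable_const_ivl)
    also have "\<dots> = \<phi> ?a / n"
      using n by (simp add: field_simps)
    finally have "integral {?a..?b} \<phi> \<le> \<phi> ?a / n" .
    moreover have "integral {0..?b} \<phi> = integral {0..?a} \<phi> + integral {?a..?b} \<phi>"
      using Henstock_Kurzweil_Integration.integral_combine[OF le(1,2) intb] by simp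
    ultimately show ?case
      using Suc by (simp add: diff_divide_distrib)
  qed simp
  from this[of n] n show ?thesis
    by simp
qed

text \<open>Once \<open>a k\<close> is at most 9, \<open>1 / sqrt (a k)\<close> grows by at least
  1/3 per step. While \<open>a k\<close> exceeds 9, each step divides it by more than 4, and
  \<open>\<kappa>\<close> bounds the length of this initial stretch.\<close>

lemma inverse_sqrt_step_rate:
  fixes a :: "nat \<Rightarrow> real"
  assumes a0: "0 < a 0" and step: "\<And>k. a (Suc k) = a k / (1 + sqrt (a k))"
    and \<kappa>: "0 \<le> \<kappa>" "1 + 1 / 2 * log (3 / 2) (a 0 / 4) \<le> \<kappa>" and k: "\<kappa> < real k"
  shows "a k \<le> 9 / (real k - \<kappa>)\<^sup>2"
proof -
  have pos: "0 < a k" for k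
    by (induction k) (auto simp: a0 step add_pos_pos intro!: divide_pos_pos)
  have dec: "a (Suc k) \<le> a k" for k
    using pos[of k] mult_left_mono[of 1 "1 + sqrt (a k)" "a k"]
    by (simp add: step divide_le_eq add_pos_pos)
  \<comment> \<open>The second conjunct measures the initial stretch; it becomes vacuous once
    \<open>a\<close> is at most 9, and stays so because \<open>a\<close> is nonincreasing.\<close>
  have "(real k - \<kappa>) / 3 \<le> 1 / sqrt (a k) \<and> (9 < a k \<longrightarrow> a k * 4 ^ k \<le> a 0)" for k
  proof (induction k)
    case 0
    have "0 \<le> 1 / sqrt (a 0)"
      using a0 by simp
    moreover have "(real 0 - \<kappa>) / 3 \<le> 0"
      using \<kappa>(1) by simp
    ultimately have "(real 0 - \<kappa>) / 3 \<le> 1 / sqrt (a 0)"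
      by (rule order_trans[rotated])
    then show ?case
      by simp
  next
    case (Suc k)
    define s where "s = sqrt (a k)"
    have s: "0 < s" and ak: "a k = s\<^sup>2"
      using pos[of k] by (auto simp: s_def)
    show ?case
    proof (cases "a k \<le> 9")
      case True
      then have "s\<^sup>2 \<le> 3\<^sup>2"
        by (simp add: ak)
      then have s3: "s \<le> 3"
        by (rule power2_le_imp_le) simp
      \<comment> \<open>The threshold 9 enters here: \<open>s * s / 9 \<le> s / 3\<close> because
        \<open>s \<le> 3\<close>.\<close>
      have "(1 / s + 1 / 3)\<^sup>2 = (1 + 2 * s / 3 + s * s / 9) / s\<^sup>2"
        using s by (simp add: power2_eq_square field_simps)
      also have "\<dots> \<le> (1 + s) / s\<^sup>2"
        using s s3 by (intro divide_right_mono) (auto simp: field_simps intro: mult_left_mono)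
      also have "\<dots> = (1 / sqrt (a (Suc k)))\<^sup>2"
        using s by (simp add: step ak power_divide real_sqrt_divide)
      finally have "1 / s + 1 / 3 \<le> 1 / sqrt (a (Suc k))"
        by (rule power2_le_imp_le) (simp add: pos less_imp_le)
      moreover have "(real k - \<kappa>) / 3 \<le> 1 / s"
        using Suc by (simp add: s_def)
      ultimately show ?thesis
        using True dec[of k] by (simp add: diff_divide_distrib add_divide_distrib)
    next
      case False
      then have big: "9 < a k" and a0k: "a k * 4 ^ k \<le> a 0"
        using Suc by auto
      \<comment> \<open>Base 3/2 is generous, since its square 9/4 is below 4. The chain gives
        \<open>k + 1 \<le> \<kappa>\<close>, so the claimed lower bound is nonpositive, hence
        trivial.\<close>
      have "(3 / 2 :: real) ^ (2 * k) \<le> 4 ^ k"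
        unfolding power_mult by (intro power_mono) (auto simp: power2_eq_square)
      also have "\<dots> \<le> a k * 4 ^ k / 4"
        using big by simp
      also have "\<dots> \<le> a 0 / 4"
        using a0k by simp
      finally have "log (3 / 2) ((3 / 2) ^ (2 * k)) \<le> log (3 / 2) (a 0 / 4)"
        by (intro log_mono) auto
      then have "2 * real k \<le> log (3 / 2) (a 0 / 4)"
        by (simp add: log_nat_power)
      then have "(real (Suc k) - \<kappa>) / 3 \<le> 0"
        using \<kappa>(2) by simp
      also have "0 \<le> 1 / sqrt (a (Suc k))"
        by (simp add: pos less_imp_le)
      finally have "(real (Suc k) - \<kappa>) / 3 \<le> 1 / sqrt (a (Suc k))" .
      moreover have "a (Suc k) * 4 ^ Suc k \<le> a 0"
      proof -
        have "3\<^sup>2 < s\<^sup>2"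
          using big by (simp add: ak)
        then have "3 < s"
          using s by - (rule power2_less_imp_less, auto)
        then have "a (Suc k) * 4 \<le> a k"
          using pos[of k] unfolding step s_def by (simp add: field_simps)
        then have "a (Suc k) * 4 * 4 ^ k \<le> a k * 4 ^ k"
          by (intro mult_right_mono) auto
        with a0k have "a (Suc k) * 4 * 4 ^ k \<le> a 0"
          by linarith
        then show ?thesis
          by (simp only: power_Suc mult.assoc)
      qed
      ultimately show ?thesis
        by blast
    qed
  qed
  then have le: "(real k - \<kappa>) / 3 \<le> 1 / sqrt (a k)"
    by blast
  have "((real k - \<kappa>) / 3)\<^sup>2 \<le> (1 / sqrt (a k))\<^sup>2"
    using k by (intro power_mono le) simp
  then have "(real k - \<kappa>)\<^sup>2 / 9 \<le> 1 / a k"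
    using pos[of k] by (simp add: power_divide)
  then show ?thesis
    using k pos[of k] by (simp add: field_simps)
qed

lemma norm_diff_scaleR_squared:
  fixes v w :: "'a::real_inner"
  shows "(norm (v - c *\<^sub>R w))\<^sup>2 = (norm v)\<^sup>2 - 2 * c * (w \<bullet> v) + c\<^sup>2 * (norm w)\<^sup>2"
  unfolding power2_norm_eq_inner
  by (simp add: inner_diff_left inner_diff_right inner_commute[of v w] power2_eq_square algebra_simps)

section \<open>Local estimates under generalized smoothness\<close>

text \<open>The real-valued core of the setting. \<open>closed_sublevel\<close> asks for closedness
  in the whole space, so \<open>F\<close> cannot stay bounded on approach to a boundary point of the
  open set \<open>X\<close>; this barrier replaces continuity of the extended-valued function on the
  closure.\<close>

locale smooth_convex =
  fixes X :: "'a::euclidean_space set" and F :: "'a \<Rightarrow> real"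
    and G :: "'a \<Rightarrow> 'a" and H :: "'a \<Rightarrow> 'a \<Rightarrow> 'a" and l :: "real \<Rightarrow> real"
  assumes openX: "open X" and convF: "convex_on X F"
    and derivF: "\<And>x. x \<in> X \<Longrightarrow> (F has_derivative (\<lambda>h. h \<bullet> G x)) (at x)"
    and derivG: "\<And>x. x \<in> X \<Longrightarrow> (G has_derivative H x) (at x)"
    and onormH: "\<And>x. x \<in> X \<Longrightarrow> onorm (H x) \<le> l (norm (G x))"
    and closed_sublevel: "\<And>c. closed {x \<in> X. F x \<le> c}"
    and l_mono: "\<And>s t. 0 \<le> s \<Longrightarrow> s \<le> t \<Longrightarrow> l s \<le> l t"
    and l_pos: "\<And>s. 0 \<le> s \<Longrightarrow> 0 < l s"
begin

section \<open>Tangents and control of the gradient along segments\<close>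

lemma convexX: "convex X"
  using convF by (simp add: convex_on_def)

lemma has_derivative_along:
  assumes "x + t *\<^sub>R d \<in> X"
  shows "((\<lambda>t. F (x + t *\<^sub>R d)) has_real_derivative d \<bullet> G (x + t *\<^sub>R d)) (at t)"
proof -
  have "((\<lambda>t. F (x + t *\<^sub>R d)) has_derivative (\<lambda>s. (s *\<^sub>R d) \<bullet> G (x + t *\<^sub>R d))) (at t)"
    by (rule has_derivative_compose[where f = "\<lambda>t. x + t *\<^sub>R d", OF _ derivF[OF assms]])
      (auto intro!: derivative_eq_intros)
  then show ?thesis
    by (simp add: has_field_derivative_def mult_commute_abs)
qed

text \<open>Restriction to the line through \<open>x\<close> and \<open>y\<close>: the parameters
  staying in \<open>X\<close> form an open convex set containing 0 and 1, so the one-variable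
  tangent inequality applies.\<close>

lemma above_tangent:
  assumes x: "x \<in> X" and y: "y \<in> X"
  shows "F x + G x \<bullet> (y - x) \<le> F y"
proof -
  let ?A = "(\<lambda>t. x + t *\<^sub>R (y - x)) -` X"
  have cont: "open ?A"
    by (rule continuous_open_vimage) (auto intro!: openX continuous_intros)
  have conv: "convex_on ?A (\<lambda>t. F (x + t *\<^sub>R (y - x)))"
  proof (rule convex_onI)
    have eq: "x + ((1 - t) *\<^sub>R r + t *\<^sub>R s) *\<^sub>R (y - x)
        = (1 - t) *\<^sub>R (x + r *\<^sub>R (y - x)) + t *\<^sub>R (x + s *\<^sub>R (y - x))" for t r s :: real
      by (simp add: algebra_simps)
    show "F (x + ((1 - t) *\<^sub>R r + t *\<^sub>R s) *\<^sub>R (y - x))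
        \<le> (1 - t) * F (x + r *\<^sub>R (y - x)) + t * F (x + s *\<^sub>R (y - x))"
      if "0 < t" "t < 1" "r \<in> ?A" "s \<in> ?A" for t r s
      unfolding eq using that convF by (intro convex_onD) auto
    show "convex ?A"
      unfolding convex_alt
    proof (intro ballI allI impI)
      fix r s u :: real
      assume "r \<in> ?A" "s \<in> ?A" "0 \<le> u \<and> u \<le> 1"
      then show "(1 - u) *\<^sub>R r + u *\<^sub>R s \<in> ?A"
        unfolding vimage_eq eq using convexX by (auto simp: convex_alt)
    qed
  qed
  then have "convex ?A"
    by (simp add: convex_on_def)
  have "F (x + 1 *\<^sub>R (y - x)) - F (x + 0 *\<^sub>R (y - x)) \<ge> ((y - x) \<bullet> G x) * (1 - 0)"
  proof (rule convex_on_imp_above_tangent[OF conv])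
    show "connected ?A"
      using \<open>convex ?A\<close> by (rule convex_connected)
    show "0 \<in> interior ?A" "1 \<in> ?A"
      using cont x y by (auto simp: interior_open)
    show "((\<lambda>t. F (x + t *\<^sub>R (y - x))) has_real_derivative (y - x) \<bullet> G x) (at 0 within ?A)"
      using has_derivative_along[of x 0 "y - x"] x by (auto intro: has_field_derivative_at_within)
  qed
  then show ?thesis
    by (simp add: inner_commute)
qed

lemma continuous_G: "continuous_on X G"
  using derivG by (meson continuous_at_imp_continuous_on has_derivative_continuous)

text \<open>Convexity bounds \<open>F\<close> along a path on which the gradient is bounded, and sublevel sets are
  closed, so such a path cannot leave \<open>X\<close>.\<close>

lemma ray_limit:
  assumes x: "x \<in> X" and t: "0 < t"
    and below: "\<And>r. \<lbrakk>0 \<le> r; r < t\<rbrakk> \<Longrightarrow> x + r *\<^sub>R d \<in> X \<and> norm (G (x + r *\<^sub>R d) - G x) \<le> s"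
  shows "x + t *\<^sub>R d \<in> X \<and> norm (G (x + t *\<^sub>R d) - G x) \<le> s"
proof -
  define c where "c = F x + t * ((norm (G x) + s) * norm d)"
  have clos: "t \<in> closure {0..<t}"
    using t by simp
  have s: "0 \<le> s"
    using below[of 0] t by simp
  have cont: "continuous_on S (\<lambda>r. x + r *\<^sub>R d)" for S
    by (intro continuous_intros)
  have "x + r *\<^sub>R d \<in> {z \<in> X. F z \<le> c}" if r: "r \<in> {0..<t}" for r
  proof -
    have z: "x + r *\<^sub>R d \<in> X" and gz: "norm (G (x + r *\<^sub>R d) - G x) \<le> s"
      using below r by auto
    \<comment> \<open>The tangent is taken at the later point and evaluated at \<open>x\<close>,
      which bounds \<open>F\<close> from above along the path.\<close>
    have "F (x + r *\<^sub>R d) + G (x + r *\<^sub>R d) \<bullet> (- (r *\<^sub>R d)) \<le> F x"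
      using above_tangent[OF z x] by simp
    then have "F (x + r *\<^sub>R d) \<le> F x + r * (G (x + r *\<^sub>R d) \<bullet> d)"
      by simp
    also have "G (x + r *\<^sub>R d) \<bullet> d \<le> norm (G (x + r *\<^sub>R d)) * norm d"
      by (rule norm_cauchy_schwarz)
    also have "norm (G (x + r *\<^sub>R d)) \<le> norm (G x) + s"
      using gz norm_triangle_sub[of "G (x + r *\<^sub>R d)" "G x"] by linarith
    also have "r * ((norm (G x) + s) * norm d) \<le> t * ((norm (G x) + s) * norm d)"
      using r s by (intro mult_right_mono) auto
    finally show ?thesis
      using z r by (simp add: c_def mult_left_mono mult_right_mono)
  qed
  then have "(\<lambda>r. x + r *\<^sub>R d) ` closure {0..<t} \<subseteq> {z \<in> X. F z \<le> c}"
    by (intro image_closure_subset[OF cont closed_sublevel]) auto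
  then have inX: "x + t *\<^sub>R d \<in> X"
    using clos by auto
  moreover have "continuous_on (closure {0..<t}) (\<lambda>r. norm (G (x + r *\<^sub>R d) - G x))"
  proof (intro continuous_intros continuous_on_compose2[OF continuous_G])
    show "(\<lambda>r. x + r *\<^sub>R d) ` closure {0..<t} \<subseteq> X"
      using below inX t by (fastforce simp: less_le)
  qed
  from continuous_le_on_closure[OF this clos, of s] below
  have "norm (G (x + t *\<^sub>R d) - G x) \<le> s"
    by auto
  ultimately show ?thesis ..
qed

text \<open>On the segment the gradient has norm at most \<open>a + s\<close>, hence the Hessian at
  most \<open>l (a + s)\<close>, and the mean value inequality applies. The a priori bound
  \<open>s\<close> thus becomes one that is linear in \<open>t\<close>.\<close>

lemma gradient_lipschitz_on_segment:
  assumes t: "0 \<le> t" and s: "0 \<le> s" and a: "norm (G x) \<le> a"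
    and seg: "\<And>r. \<lbrakk>0 \<le> r; r \<le> t\<rbrakk> \<Longrightarrow> x + r *\<^sub>R d \<in> X \<and> norm (G (x + r *\<^sub>R d) - G x) \<le> s"
  shows "norm (G (x + t *\<^sub>R d) - G x) \<le> l (a + s) * (t * norm d)"
proof -
  have in_seg: "z \<in> X \<and> norm (G z) \<le> a + s" if "z \<in> closed_segment x (x + t *\<^sub>R d)" for z
  proof -
    from that obtain u where u: "0 \<le> u" "u \<le> 1" and "z = (1 - u) *\<^sub>R x + u *\<^sub>R (x + t *\<^sub>R d)"
      by (auto simp: closed_segment_def)
    then have z: "z = x + (u * t) *\<^sub>R d"
      by (simp add: algebra_simps)
    have "u * t \<le> t" "0 \<le> u * t"
      using u t mult_right_mono[of u 1 t] by auto
    then have "z \<in> X" "norm (G z - G x) \<le> s"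
      using seg z by auto
    then show ?thesis
      using a norm_triangle_sub[of "G z" "G x"] by auto
  qed
  have "norm (G (x + t *\<^sub>R d) - G x) \<le> l (a + s) * norm (x + t *\<^sub>R d - x)"
  proof (rule differentiable_bound[where S = "closed_segment x (x + t *\<^sub>R d)"])
    fix z assume z: "z \<in> closed_segment x (x + t *\<^sub>R d)"
    show "(G has_derivative H z) (at z within closed_segment x (x + t *\<^sub>R d))"
      using derivG in_seg[OF z] has_derivative_at_withinI by blast
    show "onorm (H z) \<le> l (a + s)"
      using onormH[of z] in_seg[OF z] l_mono[of "norm (G z)" "a + s"] by fastforce
  qed auto
  then show ?thesis
    using t by simp
qed

text \<open>A bootstrap by real induction: before the end of the segment the linear bound is
  strictly below \<open>s\<close>, so continuity extends it, while \<open>ray_limit\<close> handles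
  limits.\<close>

lemma gradient_lipschitz_local:
  assumes x: "x \<in> X" and a: "norm (G x) \<le> a" and s: "0 \<le> s"
    and d: "l (a + s) * norm d \<le> s" and t: "0 \<le> t" "t \<le> 1"
  shows "x + t *\<^sub>R d \<in> X" and "norm (G (x + t *\<^sub>R d) - G x) \<le> l (a + s) * (t * norm d)"
proof -
  have a0: "0 \<le> a"
    using a norm_ge_zero order_trans by blast
  have K: "0 < l (a + s)"
    using a0 s by (simp add: l_pos)
  have path: "x + t *\<^sub>R d \<in> X \<and> norm (G (x + t *\<^sub>R d) - G x) \<le> s" if t: "0 \<le> t" "t \<le> 1" for t
  proof (cases "d = 0")
    case True
    then show ?thesis
      using x s by simp
  next
    case False
    let ?P = "\<lambda>r. x + r *\<^sub>R d \<in> X \<and> norm (G (x + r *\<^sub>R d) - G x) \<le> s"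
    show ?thesis
    proof (rule real_unit_interval_induct[of ?P, OF _ _ _ t])
      show "?P 0"
        using x s by simp
      show "?P t" if "0 < t" "t \<le> 1" "\<And>r. \<lbrakk>0 \<le> r; r < t\<rbrakk> \<Longrightarrow> ?P r" for t
        using that ray_limit[OF x] by blast
      show "\<exists>e>0. \<forall>r. t < r \<and> r < t + e \<longrightarrow> ?P r"
        if t: "0 \<le> t" "t < 1" and seg: "\<And>r. \<lbrakk>0 \<le> r; r \<le> t\<rbrakk> \<Longrightarrow> ?P r" for t
      proof -
        have inX: "x + t *\<^sub>R d \<in> X"
          using seg t by blast
        have "norm (G (x + t *\<^sub>R d) - G x) \<le> l (a + s) * (t * norm d)"
          using gradient_lipschitz_on_segment[OF t(1) s a] seg by blast
        \<comment> \<open>Strictness comes from \<open>t < 1\<close> and a nonzero displacement,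
          which is why \<open>d = 0\<close> is treated apart.\<close>
        also have "\<dots> < l (a + s) * norm d"
          using False t K by simp
        also note d
        finally have less: "norm (G (x + t *\<^sub>R d) - G x) < s" .
        have "isCont G (x + t *\<^sub>R d)"
          using derivG[OF inX] by (rule has_derivative_continuous)
        then have cont: "isCont (\<lambda>r. norm (G (x + r *\<^sub>R d) - G x)) t"
          by (intro continuous_norm continuous_diff continuous_const
              isCont_o2[where g = G and f = "\<lambda>r. x + r *\<^sub>R d"] continuous_add continuous_scaleR
              continuous_ident)
        have "isCont (\<lambda>r. x + r *\<^sub>R d) t"
          by (intro continuous_add continuous_const continuous_scaleR continuous_ident)
        then have "\<forall>\<^sub>F r in at t. x + r *\<^sub>R d \<in> X"
          using topological_tendstoD[OF _ openX inX] by (simp add: isCont_def)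
        moreover have "\<forall>\<^sub>F r in at t. norm (G (x + r *\<^sub>R d) - G x) < s"
          using order_tendstoD(2)[OF _ less] cont by (simp add: isCont_def)
        ultimately have "\<forall>\<^sub>F r in at t. ?P r"
          by eventually_elim auto
        then obtain e where "e > 0" "\<And>r. r \<noteq> t \<Longrightarrow> dist r t < e \<Longrightarrow> ?P r"
          by (auto simp: eventually_at)
        then show ?thesis
          by (intro exI[of _ e]) (auto simp: dist_real_def)
      qed
    qed
  qed
  show "x + t *\<^sub>R d \<in> X"
    using path t by blast
  show "norm (G (x + t *\<^sub>R d) - G x) \<le> l (a + s) * (t * norm d)"
    by (rule gradient_lipschitz_on_segment[OF t(1) s a]) (use path t in auto)
qed

text \<open>The usual quadratic upper bound: with the quadratic model subtracted, the function of
  \<open>t\<close> has nonpositive derivative by the local Lipschitz estimate.\<close>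

lemma descent:
  assumes x: "x \<in> X" and a: "norm (G x) \<le> a" and s: "0 \<le> s"
    and d: "l (a + s) * norm d \<le> s"
  shows "F (x + d) \<le> F x + G x \<bullet> d + l (a + s) / 2 * (norm d)\<^sup>2"
proof -
  let ?K = "l (a + s)"
  let ?\<phi> = "\<lambda>t. F (x + t *\<^sub>R d) - t * (G x \<bullet> d) - ?K / 2 * t\<^sup>2 * (norm d)\<^sup>2"
  have "?\<phi> 1 \<le> ?\<phi> 0"
  proof (rule DERIV_nonpos_imp_nonincreasing[of 0 1 ?\<phi>])
    fix t :: real assume t: "0 \<le> t" "t \<le> 1"
    let ?z = "x + t *\<^sub>R d"
    have "(?\<phi> has_real_derivative (d \<bullet> G ?z - G x \<bullet> d - ?K * t * (norm d)\<^sup>2)) (at t)"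
      by (rule derivative_eq_intros has_derivative_along gradient_lipschitz_local assms t refl
          | simp add: power2_eq_square)+
    moreover have "d \<bullet> G ?z - G x \<bullet> d \<le> norm (G ?z - G x) * norm d"
      using norm_cauchy_schwarz[of "G ?z - G x" d] by (simp add: inner_diff_left inner_diff_right inner_commute)
    moreover have "norm (G ?z - G x) * norm d \<le> ?K * t * (norm d)\<^sup>2"
      using mult_right_mono[OF gradient_lipschitz_local(2)[OF assms t], of "norm d"]
      by (simp add: power2_eq_square algebra_simps)
    ultimately show "\<exists>y. (?\<phi> has_real_derivative y) (at t) \<and> y \<le> 0"
      by (intro exI[of _ "d \<bullet> G ?z - G x \<bullet> d - ?K * t * (norm d)\<^sup>2"]) linarith
  qed simp
  then show ?thesis
    by simp
qed

text \<open>From \<open>x\<close>, step against the gradient difference with step size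
  \<open>1 / M\<close>, the minimizer of the quadratic model of \<open>F\<close> minus its tangent
  at \<open>y\<close>. At the new point the tangent at \<open>y\<close> bounds \<open>F\<close> from
  below and \<open>descent\<close> bounds it from above; \<open>s\<close> is large enough for the
  step to be admissible.\<close>

lemma cocoercive:
  assumes x: "x \<in> X" and y: "y \<in> X" and a: "norm (G x) \<le> a"
    and s: "norm (G y - G x) \<le> s" and M: "l (a + s) \<le> M"
  shows "F y + G y \<bullet> (x - y) + (norm (G x - G y))\<^sup>2 / (2 * M) \<le> F x"
proof -
  define \<Delta> where "\<Delta> = G x - G y"
  define d where "d = - (1 / M) *\<^sub>R \<Delta>"
  have s0: "0 \<le> s" and a0: "0 \<le> a"
    using s a norm_ge_zero order_trans by blast+
  then have M0: "0 < M"
    using M l_pos[of "a + s"] by simp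
  have nd: "norm d = norm \<Delta> / M"
    using M0 by (simp add: d_def)
  have "l (a + s) * norm d \<le> M * (norm \<Delta> / M)"
    unfolding nd using M M0 by (intro mult_right_mono) auto
  also have "\<dots> \<le> s"
    using s M0 by (simp add: \<Delta>_def norm_minus_commute)
  finally have d: "l (a + s) * norm d \<le> s" .
  have z: "x + d \<in> X"
    using gradient_lipschitz_local(1)[OF x a s0 d, of 1] by simp
  have "F y + G y \<bullet> (x - y) + G y \<bullet> d \<le> F (x + d)"
    using above_tangent[OF y z] by (simp add: algebra_simps)
  also have "\<dots> \<le> F x + G x \<bullet> d + l (a + s) / 2 * (norm d)\<^sup>2"
    by (rule descent[OF x a s0 d])
  also have "\<dots> \<le> F x + G x \<bullet> d + M / 2 * (norm d)\<^sup>2"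
    using M by (intro add_left_mono mult_right_mono) auto
  finally have "F y + G y \<bullet> (x - y) \<le> F x + \<Delta> \<bullet> d + M / 2 * (norm d)\<^sup>2"
    by (simp add: \<Delta>_def inner_diff_left)
  also have "\<Delta> \<bullet> d = - ((norm \<Delta>)\<^sup>2 / M)"
    by (simp add: d_def power2_norm_eq_inner)
  also have "M / 2 * (norm d)\<^sup>2 = (norm \<Delta>)\<^sup>2 / M / 2"
    unfolding nd using M0 by (simp add: power2_eq_square field_simps)
  finally show ?thesis
    by (simp add: \<Delta>_def)
qed

text \<open>Where the gradient is at most \<open>a + j * h\<close>, a displacement of length
  \<open>h / l (a + (j + 1) * h)\<close> changes it by at most \<open>h\<close>; such local steps
  are chained.\<close>

lemma gradient_change_step_sum:
  assumes x: "x \<in> X" and a: "norm (G x) \<le> a" and h: "0 \<le> h"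
  shows "norm d \<le> (\<Sum>j<n. h / l (a + real (Suc j) * h))
    \<Longrightarrow> x + d \<in> X \<and> norm (G (x + d) - G x) \<le> real n * h"
proof (induction n arbitrary: d)
  case 0
  then show ?case
    using x by simp
next
  case (Suc n)
  let ?S = "\<Sum>j<n. h / l (a + real (Suc j) * h)"
  show ?case
  proof (cases "norm d \<le> ?S")
    case True
    then show ?thesis
      using Suc.IH[OF True] h by (auto simp: algebra_simps)
  next
    case False
    have a0: "0 \<le> a"
      using a norm_ge_zero order_trans by blast
    have S0: "0 \<le> ?S"
      using h a0 by (intro sum_nonneg divide_nonneg_pos l_pos) auto
    then have d0: "0 < norm d"
      using False by linarith
    \<comment> \<open>The displacement is cut at length \<open>?S\<close>: the induction hypothesis
      covers \<open>d1\<close>, a single local step from \<open>x + d1\<close> covers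
      \<open>d2\<close>.\<close>
    define d1 where "d1 = (?S / norm d) *\<^sub>R d"
    define d2 where "d2 = (1 - ?S / norm d) *\<^sub>R d"
    have d12: "d = d1 + d2"
      by (simp add: d1_def d2_def algebra_simps)
    have "norm d1 = ?S"
      using S0 d0 by (simp add: d1_def)
    with Suc.IH[of d1] have p: "x + d1 \<in> X" "norm (G (x + d1) - G x) \<le> real n * h"
      by auto
    have gp: "norm (G (x + d1)) \<le> a + real n * h"
      using p(2) a norm_triangle_sub[of "G (x + d1)" "G x"] by linarith
    have "norm d2 = (1 - ?S / norm d) * norm d"
      using d0 False by (simp add: d2_def)
    also have "\<dots> = norm d - ?S"
      using d0 by (simp add: field_simps)
    finally have "norm d2 \<le> h / l (a + real (Suc n) * h)"
      using Suc.prems by simp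
    then have d2: "l (a + real n * h + h) * norm d2 \<le> h"
      using l_pos[of "a + real (Suc n) * h"] a0 h by (simp add: field_simps)
    have q: "x + d1 + d2 \<in> X" "norm (G (x + d1 + d2) - G (x + d1)) \<le> h"
      using gradient_lipschitz_local[OF p(1) gp h d2, of 1] d2 by auto
    have "norm (G (x + d) - G x) \<le> norm (G (x + d1 + d2) - G (x + d1)) + norm (G (x + d1) - G x)"
      using norm_triangle_ineq[of "G (x + d1 + d2) - G (x + d1)" "G (x + d1) - G x"]
      by (simp add: d12 add.assoc)
    then show ?thesis
      using p q by (simp add: d12 algebra_simps)
  qed
qed

text \<open>With \<open>h = s / n\<close> the sums of the preceding lemma are right Riemann sums of
  the integral. They cover every strictly shorter displacement for large \<open>n\<close>; the
  endpoint follows by \<open>ray_limit\<close>.\<close>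

lemma gradient_change_integral:
  assumes x: "x \<in> X" and a: "norm (G x) \<le> a" and s: "0 \<le> s"
    and d: "norm d \<le> s * integral {0..1} (\<lambda>v. 1 / l (a + s * v))"
  shows "x + d \<in> X" and "norm (G (x + d) - G x) \<le> s"
proof -
  let ?\<phi> = "\<lambda>v. 1 / l (a + s * v)"
  let ?I = "integral {0..1} ?\<phi>"
  have a0: "0 \<le> a"
    using a norm_ge_zero order_trans by blast
  have anti: "antimono_on {0..1} ?\<phi>"
    using a0 s by (auto simp: monotone_on_def intro!: divide_left_mono l_mono l_pos mult_pos_pos mult_left_mono)
  have path: "x + r *\<^sub>R d \<in> X \<and> norm (G (x + r *\<^sub>R d) - G x) \<le> s" if r: "0 \<le> r" "r < 1" for r
  proof (cases "norm d = 0")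
    case True
    then show ?thesis
      using x s by simp
  next
    case False
    then have "r * norm d < 1 * norm d"
      using r by (intro mult_strict_right_mono) auto
    then have "norm (r *\<^sub>R d) < s * ?I"
      using r d by simp
    then have gap: "0 < s * ?I - norm (r *\<^sub>R d)"
      by simp
    \<comment> \<open>The index makes the Riemann error
      \<open>s * (?\<phi> 0 - ?\<phi> 1) / n\<close> smaller than the slack.\<close>
    obtain n where n: "s * (?\<phi> 0 - ?\<phi> 1) < real n * (s * ?I - norm (r *\<^sub>R d))"
      using reals_Archimedean3[OF gap] by blast
    have \<phi>01: "0 \<le> ?\<phi> 0 - ?\<phi> 1"
      using monotone_onD[OF anti, of 0 1] by simp
    then have n0: "0 < n"
      using n s by (cases "n = 0") (auto simp: mult_less_0_iff)
    have less: "s * (?\<phi> 0 - ?\<phi> 1) / n < s * ?I - norm (r *\<^sub>R d)"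
      using n n0 by (simp only: divide_less_eq mult.commute of_nat_0_less_iff if_True)
    have "s * ?I \<le> s * ((\<Sum>j<n. ?\<phi> (real (Suc j) / n) / n) + (?\<phi> 0 - ?\<phi> 1) / n)"
      by (intro mult_left_mono integral_antimono_le_right_sum anti n0 s)
    also have "\<dots> = (\<Sum>j<n. (s / n) / l (a + real (Suc j) * (s / n))) + s * (?\<phi> 0 - ?\<phi> 1) / n"
      by (simp add: distrib_left sum_distrib_left field_simps)
    finally have "norm (r *\<^sub>R d) \<le> (\<Sum>j<n. (s / n) / l (a + real (Suc j) * (s / n)))"
      using less by linarith
    from gradient_change_step_sum[OF x a _ this] show ?thesis
      using s n0 by simp
  qed
  show "x + d \<in> X" "norm (G (x + d) - G x) \<le> s"
    using ray_limit[OF x zero_less_one, of d s] path by auto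
qed

end

section \<open>Gradient descent and its accelerated variant\<close>

context smooth_convex
begin

definition step_size :: "'a \<Rightarrow> real" where
  "step_size x = integral {0..1} (\<lambda>v. 1 / l (norm (G x) + norm (G x) * v))"

text \<open>The integrand is nonincreasing, so its values at 1 and 0 bound the integral. The lower
  bound gives the decrease of \<open>F\<close>, the upper one control of the distance to a
  minimizer.\<close>

lemma step_size_bounds:
  shows "1 / l (2 * norm (G x)) \<le> step_size x" and "step_size x \<le> 1 / l (norm (G x))"
proof -
  let ?a = "norm (G x)" and ?\<phi> = "\<lambda>v. 1 / l (norm (G x) + norm (G x) * v)"
  have anti: "antimono_on {0..1} ?\<phi>"
    by (auto simp: monotone_on_def intro!: divide_left_mono l_mono l_pos mult_pos_pos mult_left_mono)
  note int = integrable_on_antimono_on[OF anti]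
  have "integral {0..1} (\<lambda>_::real. ?\<phi> 1) \<le> step_size x"
    unfolding step_size_def using monotone_onD[OF anti, of _ 1]
    by (intro integral_le int integrable_const_ivl) auto
  then show "1 / l (2 * ?a) \<le> step_size x"
    by simp
  have "step_size x \<le> integral {0..1} (\<lambda>_::real. ?\<phi> 0)"
    unfolding step_size_def using monotone_onD[OF anti, of 0]
    by (intro integral_le int integrable_const_ivl) auto
  then show "step_size x \<le> 1 / l ?a"
    by simp
qed

text \<open>The shorter step \<open>r\<close> reaches \<open>?p\<close>, where
  \<open>descent\<close> gives the claimed decrease. Up to the full step the gradient changes by at
  most its own norm, so at \<open>?q\<close> it still has nonnegative inner product with
  \<open>G x\<close>; the tangent at \<open>?q\<close> then shows that \<open>F\<close> is no larger
  there than at \<open>?p\<close>.\<close>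

lemma gd_step:
  assumes x: "x \<in> X"
  shows "x - step_size x *\<^sub>R G x \<in> X"
    and "F (x - step_size x *\<^sub>R G x) \<le> F x - (norm (G x))\<^sup>2 / (2 * l (2 * norm (G x)))"
proof -
  let ?a = "norm (G x)" and ?\<eta> = "step_size x"
  define r where "r = 1 / l (2 * ?a)"
  have r: "0 < r"
    by (simp add: r_def l_pos)
  have r\<eta>: "r \<le> ?\<eta>"
    unfolding r_def by (rule step_size_bounds)
  have lr: "l (?a + ?a) * r = 1"
    using l_pos[of "2 * ?a"] by (simp add: r_def flip: mult_2)
  \<comment> \<open>The step size is exactly the one for which the admissible gradient change equals
    the gradient norm.\<close>
  have "norm (- (?\<eta> *\<^sub>R G x)) \<le> ?a * integral {0..1} (\<lambda>v. 1 / l (?a + ?a * v))"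
    using r r\<eta> by (simp flip: step_size_def)
  from gradient_change_integral[OF x order_refl norm_ge_zero this]
  have q: "x - ?\<eta> *\<^sub>R G x \<in> X" and Gq: "norm (G (x - ?\<eta> *\<^sub>R G x) - G x) \<le> ?a"
    by auto
  show "x - ?\<eta> *\<^sub>R G x \<in> X"
    by (rule q)
  let ?q = "x - ?\<eta> *\<^sub>R G x" and ?p = "x + (- (r *\<^sub>R G x))"
  have d: "l (?a + ?a) * norm (- (r *\<^sub>R G x)) \<le> ?a"
    using r lr by (simp flip: mult.assoc)
  have p: "?p \<in> X"
    using gradient_lipschitz_local(1)[OF x order_refl norm_ge_zero d, of 1] by simp
  have "G ?q \<bullet> G x = (G ?q - G x) \<bullet> G x + ?a\<^sup>2"
    by (simp add: inner_diff_left power2_norm_eq_inner)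
  moreover have "\<bar>(G ?q - G x) \<bullet> G x\<bar> \<le> ?a * ?a"
    using Cauchy_Schwarz_ineq2[of "G ?q - G x" "G x"] mult_right_mono[OF Gq, of ?a] by simp
  ultimately have "0 \<le> G ?q \<bullet> G x"
    by (simp add: power2_eq_square)
  then have "0 \<le> (?\<eta> - r) * (G ?q \<bullet> G x)"
    using r\<eta> by simp
  then have "0 \<le> G ?q \<bullet> (?p - ?q)"
    by (simp add: inner_diff_right left_diff_distrib)
  then have "F ?q \<le> F ?p"
    using above_tangent[OF q p] by linarith
  also have "\<dots> \<le> F x + G x \<bullet> (- (r *\<^sub>R G x)) + l (?a + ?a) / 2 * (norm (- (r *\<^sub>R G x)))\<^sup>2"
    by (rule descent[OF x order_refl norm_ge_zero d])
  also have "\<dots> = F x - r * ?a\<^sup>2 + (l (?a + ?a) * r) * r / 2 * ?a\<^sup>2"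
    by (simp add: power2_norm_eq_inner power_mult_distrib) (simp add: power2_eq_square)
  also have "\<dots> = F x - ?a\<^sup>2 / (2 * l (2 * ?a))"
    unfolding lr by (simp add: r_def)
  finally show "F ?q \<le> F x - ?a\<^sup>2 / (2 * l (2 * ?a))" .
qed

end

section \<open>Gradient descent towards a minimizer\<close>

locale smooth_convex_min = smooth_convex +
  fixes xs
  assumes xs: "xs \<in> X" and minimal: "\<And>x. x \<in> X \<Longrightarrow> F xs \<le> F x"
begin

lemma gradient_minimizer: "G xs = 0"
proof -
  have "(\<lambda>h. h \<bullet> G xs) = (\<lambda>h. 0)"
    using differential_zero_maxmin[OF xs openX derivF[OF xs]] minimal by blast
  then have "G xs \<bullet> G xs = 0"
    by meson
  then show ?thesis
    by simp
qed

text \<open>Cocoercivity based at the minimizer: the gradient there is 0, so \<open>l\<close> is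
  evaluated at \<open>norm (G x)\<close> only.\<close>

lemma gradient_inner_ge:
  assumes x: "x \<in> X"
  shows "(norm (G x))\<^sup>2 / (2 * l (norm (G x))) \<le> G x \<bullet> (x - xs)"
proof -
  have "F x + G x \<bullet> (xs - x) + (norm (G x))\<^sup>2 / (2 * l (norm (G x))) \<le> F xs"
    using cocoercive[OF xs x, of 0 "norm (G x)" "l (norm (G x))"] by (simp add: gradient_minimizer)
  moreover have "G x \<bullet> (x - xs) = - (G x \<bullet> (xs - x))"
    by (simp add: inner_diff_right)
  ultimately show ?thesis
    using minimal[OF x] by linarith
qed

text \<open>Cocoercivity with the roles exchanged: the base gradient and its change both have norm
  \<open>norm (G x)\<close>, whence the factor 2 inside \<open>l\<close>.\<close>

lemma gap_ge:
  assumes x: "x \<in> X"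
  shows "(norm (G x))\<^sup>2 / (2 * l (2 * norm (G x))) \<le> F x - F xs"
proof -
  have s: "norm (G xs - G x) \<le> norm (G x)"
    by (simp add: gradient_minimizer)
  have M: "l (norm (G x) + norm (G x)) \<le> l (2 * norm (G x))"
    by (simp only: mult_2 order_refl)
  show ?thesis
    using cocoercive[OF x xs order_refl s M] unfolding gradient_minimizer by simp
qed

text \<open>After expanding the square, \<open>gradient_inner_ge\<close> absorbs the quadratic term.
  Both phases use this, the second with step \<open>\<gamma>\<close>.\<close>

lemma gradient_step_distance:
  assumes x: "x \<in> X" and \<eta>: "0 \<le> \<eta>" "\<eta> \<le> 1 / l (norm (G x))"
  shows "norm (x - \<eta> *\<^sub>R G x - xs) \<le> norm (x - xs)"
proof -
  let ?a = "norm (G x)"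
  have "\<eta> * ?a\<^sup>2 \<le> 1 / l ?a * ?a\<^sup>2"
    using \<eta> by (intro mult_right_mono) auto
  also have "\<dots> \<le> 2 * (G x \<bullet> (x - xs))"
    using gradient_inner_ge[OF x] by (simp add: field_simps)
  finally have le: "\<eta> * (\<eta> * ?a\<^sup>2) \<le> \<eta> * (2 * (G x \<bullet> (x - xs)))"
    using \<eta>(1) by (intro mult_left_mono)
  have eq: "x - \<eta> *\<^sub>R G x - xs = (x - xs) - \<eta> *\<^sub>R G x"
    by simp
  have "(norm (x - \<eta> *\<^sub>R G x - xs))\<^sup>2
      = (norm (x - xs))\<^sup>2 - \<eta> * (2 * (G x \<bullet> (x - xs))) + \<eta> * (\<eta> * ?a\<^sup>2)"
    unfolding eq by (simp add: norm_diff_scaleR_squared power2_eq_square[of \<eta>])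
  with le show ?thesis
    by - (rule power2_le_imp_le, auto)
qed

lemma gd_invariant:
  assumes x0: "x 0 \<in> X" and step: "\<And>j. x (Suc j) = x j - step_size (x j) *\<^sub>R G (x j)"
  shows "x j \<in> X \<and> norm (x j - xs) \<le> norm (x 0 - xs)"
proof (induction j)
  case (Suc j)
  have "0 \<le> 1 / l (2 * norm (G (x j)))"
    by (simp add: l_pos less_imp_le)
  then have "0 \<le> step_size (x j)"
    using step_size_bounds(1) order_trans by blast
  then have "norm (x (Suc j) - xs) \<le> norm (x j - xs)"
    unfolding step using Suc by (intro gradient_step_distance step_size_bounds(2)) auto
  then show ?case
    using gd_step(1)[of "x j"] Suc step[of j] by auto
qed (simp add: x0)

text \<open>A gap above \<open>\<epsilon>\<close> forces gradients larger than
  \<open>\<epsilon> / R\<close>, as the distance to the minimizer never grows. Monotonicity of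
  \<open>?\<psi>\<close> turns this into a fixed decrease per step, which contradicts boundedness
  below.\<close>

lemma gd_reaches:
  assumes x0: "x 0 \<in> X" and step: "\<And>j. x (Suc j) = x j - step_size (x j) *\<^sub>R G (x j)"
    and mono: "strict_mono_on {0..} (\<lambda>s. s\<^sup>2 / (2 * l (4 * s)))" and \<epsilon>: "0 < \<epsilon>"
  shows "\<exists>j. F (x j) - F xs \<le> \<epsilon>"
proof (rule ccontr)
  assume "\<not> ?thesis"
  then have gap: "\<epsilon> < F (x j) - F xs" for j
    by (simp add: not_le)
  let ?\<psi> = "\<lambda>s. s\<^sup>2 / (2 * l (4 * s))"
  note inv = gd_invariant[of x, OF x0 step]
  define R where "R = norm (x 0 - xs)"
  have grad: "\<epsilon> < norm (G (x j)) * R" for j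
  proof -
    have "\<epsilon> < G (x j) \<bullet> (x j - xs)"
      using gap[of j] above_tangent[of "x j" xs] inv[of j] xs by (simp add: inner_diff_right)
    also have "\<dots> \<le> norm (G (x j)) * norm (x j - xs)"
      by (rule norm_cauchy_schwarz)
    also have "\<dots> \<le> norm (G (x j)) * R"
      unfolding R_def using inv by (intro mult_left_mono) auto
    finally show ?thesis .
  qed
  have R: "0 < R"
    using grad[of 0] \<epsilon> by (cases "R = 0") (auto simp: R_def)
  define c where "c = \<epsilon> / R"
  have c: "0 < c"
    using R \<epsilon> by (simp add: c_def)
  have dec: "F (x (Suc j)) \<le> F (x j) - ?\<psi> c" for j
  proof -
    let ?a = "norm (G (x j))"
    have "c < ?a"
      using grad[of j] R by (simp add: c_def divide_less_eq)
    then have "?\<psi> c < ?\<psi> ?a"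
      using c by (intro strict_mono_onD[OF mono]) auto
    \<comment> \<open>Since \<open>l (2 * ?a) \<le> l (4 * ?a)\<close>, \<open>?\<psi>\<close>
      underestimates the guaranteed decrease.\<close>
    also have "\<dots> \<le> ?a\<^sup>2 / (2 * l (2 * ?a))"
      by (intro divide_left_mono mult_left_mono l_mono mult_pos_pos l_pos) auto
    finally show ?thesis
      using gd_step(2)[of "x j"] inv[of j] by (simp add: step)
  qed
  have sum: "F (x j) \<le> F (x 0) - real j * ?\<psi> c" for j
  proof (induction j)
    case (Suc j)
    then show ?case
      using dec[of j] unfolding of_nat_Suc distrib_right by linarith
  qed simp
  have "0 < ?\<psi> c"
    using c l_pos[of "4 * c"] by simp
  then obtain n where "F (x 0) - F xs < real n * ?\<psi> c"
    by (meson reals_Archimedean3)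
  then show False
    using sum[of n] minimal[of "x n"] inv[of n] by linarith
qed

text \<open>The condition on \<open>\<delta>\<close> says that \<open>?\<psi>\<close> at
  \<open>2 * ?D\<close> is at least \<open>\<delta>\<close>, so a larger gradient would force a gap
  above \<open>\<delta>\<close> by \<open>gap_ge\<close>.\<close>

lemma gradient_le_of_gap:
  assumes mono: "strict_mono_on {0..} (\<lambda>s. s\<^sup>2 / (2 * l (4 * s)))"
    and \<delta>: "0 < \<delta>" "l (8 * sqrt (\<delta> * l 0)) \<le> 2 * l 0"
    and x: "x \<in> X" and gap: "F x - F xs \<le> \<delta>"
  shows "norm (G x) \<le> 2 * sqrt (\<delta> * l 0)"
proof (rule ccontr)
  let ?\<psi> = "\<lambda>s. s\<^sup>2 / (2 * l (4 * s))" and ?a = "norm (G x)" and ?D = "sqrt (\<delta> * l 0)"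
  assume "\<not> ?a \<le> 2 * ?D"
  have l0: "0 < l 0"
    by (simp add: l_pos)
  have D: "0 < ?D" "?D\<^sup>2 = \<delta> * l 0"
    using \<delta>(1) l0 by auto
  have "\<delta> = (2 * ?D)\<^sup>2 / (2 * (2 * l 0))"
    using l0 D(2) by (simp add: power_mult_distrib)
  also have "\<dots> \<le> ?\<psi> (2 * ?D)"
    using \<delta>(2) D(1) l0 by (intro divide_left_mono mult_left_mono mult_pos_pos l_pos) auto
  also have "\<dots> < ?\<psi> ?a"
    using \<open>\<not> ?a \<le> 2 * ?D\<close> D(1) by (intro strict_mono_onD[OF mono]) auto
  also have "\<dots> \<le> ?a\<^sup>2 / (2 * l (2 * ?a))"
    by (intro divide_left_mono mult_left_mono l_mono mult_pos_pos l_pos) auto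
  also have "\<dots> \<le> \<delta>"
    using gap_ge[OF x] gap by linarith
  finally show False
    by simp
qed

text \<open>Preservation of the invariant by one step of the second phase. The distance of
  \<open>y\<close> is carried separately, because the energy controls only that of
  \<open>u\<close>.\<close>

lemma accelerated_step:
  fixes y u :: 'a
  assumes mono: "strict_mono_on {0..} (\<lambda>s. s\<^sup>2 / (2 * l (4 * s)))"
    and \<delta>: "0 < \<delta>" "l (8 * sqrt (\<delta> * l 0)) \<le> 2 * l 0"
    and R: "0 < R" and \<Gamma>: "0 < \<Gamma>" "\<Gamma> * R\<^sup>2 \<le> \<delta>"
    and y: "y \<in> X" and disty: "(norm (y - xs))\<^sup>2 \<le> 2 * R\<^sup>2"
    and energy: "F y - F xs + \<Gamma> / 2 * (norm (u - xs))\<^sup>2 \<le> \<Gamma> * R\<^sup>2"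
  defines "\<gamma> \<equiv> 1 / (2 * l 0)"
  defines "\<alpha> \<equiv> sqrt (\<gamma> * \<Gamma>)"
  defines "y' \<equiv> (1 / (1 + \<alpha>)) *\<^sub>R y + (\<alpha> / (1 + \<alpha>)) *\<^sub>R u - (\<gamma> / (1 + \<alpha>)) *\<^sub>R G y"
  defines "u' \<equiv> closest_point (closure X) (u - (\<alpha> / \<Gamma>) *\<^sub>R G y')"
  shows "y' \<in> X" and "(norm (y' - xs))\<^sup>2 \<le> 2 * R\<^sup>2"
    and "F y' - F xs + \<Gamma> / (1 + \<alpha>) / 2 * (norm (u' - xs))\<^sup>2 \<le> \<Gamma> / (1 + \<alpha>) * R\<^sup>2"
proof -
  define D where "D = sqrt (\<delta> * l 0)"
  define S where "S = sqrt 2 * R"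
  have l0: "0 < l 0"
    by (simp add: l_pos)
  have D: "0 < D" "D\<^sup>2 = \<delta> * l 0" and l8: "l (8 * D) \<le> 2 * l 0"
    using \<delta> l0 by (auto simp: D_def)
  have S: "0 < S" "S\<^sup>2 = 2 * R\<^sup>2"
    using R by (auto simp: S_def power_mult_distrib)
  have \<gamma>: "0 < \<gamma>"
    using l0 by (simp add: \<gamma>_def)
  have \<alpha>: "0 < \<alpha>" "\<alpha>\<^sup>2 = \<gamma> * \<Gamma>"
    using \<gamma> \<Gamma> by (auto simp: \<alpha>_def)
  have "0 \<le> \<Gamma> / 2 * (norm (u - xs))\<^sup>2"
    using \<Gamma> by simp
  then have Gy: "norm (G y) \<le> 2 * D"
    unfolding D_def using energy \<Gamma> by (intro gradient_le_of_gap[OF mono \<delta> y]) linarith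
  have "\<Gamma> / 2 * (norm (u - xs))\<^sup>2 \<le> \<Gamma> / 2 * S\<^sup>2"
    using energy minimal[OF y] S(2) by simp
  then have "(norm (u - xs))\<^sup>2 \<le> S\<^sup>2"
    using \<Gamma> by simp
  then have u: "norm (u - xs) \<le> S"
    using S(1) by - (rule power2_le_imp_le, auto)
  have yS: "norm (y - xs) \<le> S"
    using disty S by - (rule power2_le_imp_le, auto)
  \<comment> \<open>The bound \<open>\<Gamma> * R\<^sup>2 \<le> \<delta>\<close> ties the momentum
    weight to the gradient scale \<open>D\<close>.\<close>
  have \<alpha>S: "\<alpha> * S \<le> D / l 0"
  proof (rule power2_le_imp_le)
    have "(\<alpha> * S)\<^sup>2 = \<Gamma> * R\<^sup>2 / l 0"
      using l0 by (simp add: power_mult_distrib \<alpha>(2) S(2) \<gamma>_def field_simps)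
    also have "\<dots> \<le> \<delta> / l 0"
      using \<Gamma> l0 by (intro divide_right_mono) auto
    also have "\<dots> = (D / l 0)\<^sup>2"
      unfolding power_divide D(2) using l0 by (simp add: power2_eq_square)
    finally show "(\<alpha> * S)\<^sup>2 \<le> (D / l 0)\<^sup>2" .
  qed (use D l0 in simp)
  have scaled: "(1 + \<alpha>) *\<^sub>R y' = y + \<alpha> *\<^sub>R u - \<gamma> *\<^sub>R G y"
    unfolding y'_def using \<alpha>(1) by (simp add: scaleR_diff_right scaleR_add_right)

  \<comment> \<open>Length of the step from \<open>y\<close> to \<open>y'\<close>\<close>
  define d where "d = y' - y"
  have "(1 + \<alpha>) * norm d = norm ((1 + \<alpha>) *\<^sub>R d)"
    using \<alpha>(1) by simp
  also have "(1 + \<alpha>) *\<^sub>R d = \<alpha> *\<^sub>R (u - xs) - \<alpha> *\<^sub>R (y - xs) - \<gamma> *\<^sub>R G y"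
    unfolding d_def scaleR_diff_right scaled by (simp add: algebra_simps)
  also have "norm \<dots> \<le> norm (\<alpha> *\<^sub>R (u - xs)) + norm (\<alpha> *\<^sub>R (y - xs)) + norm (\<gamma> *\<^sub>R G y)"
    by (meson add_right_mono norm_triangle_ineq4 order_trans)
  also have "\<dots> = \<alpha> * norm (u - xs) + \<alpha> * norm (y - xs) + \<gamma> * norm (G y)"
    using \<alpha>(1) \<gamma> by simp
  also have "\<dots> \<le> \<alpha> * S + \<alpha> * S + \<gamma> * (2 * D)"
    using \<alpha>(1) \<gamma> u yS Gy by (intro add_mono mult_left_mono) auto
  also have "\<dots> \<le> D / l 0 + D / l 0 + D / l 0"
    using \<alpha>S by (intro add_mono) (simp_all add: \<gamma>_def)
  finally have "norm d + \<alpha> * norm d \<le> 3 * (D / l 0)"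
    by (simp add: distrib_right)
  moreover have "0 \<le> \<alpha> * norm d"
    using \<alpha>(1) by simp
  ultimately have nd: "norm d \<le> 3 * (D / l 0)"
    by linarith
  \<comment> \<open>The sum \<open>2 * D + 6 * D\<close> is exactly the argument at which the choice
    of \<open>\<delta>\<close> bounds \<open>l\<close> by \<open>2 * l 0\<close>.\<close>
  have "l (2 * D + 6 * D) * norm d \<le> 2 * l 0 * (3 * (D / l 0))"
    using l8 nd l0 by (intro mult_mono) auto
  then have d: "l (2 * D + 6 * D) * norm d \<le> 6 * D"
    using l0 by simp
  have D6: "0 \<le> 6 * D"
    using D by simp
  have "y + 1 *\<^sub>R d \<in> X" "norm (G (y + 1 *\<^sub>R d) - G y) \<le> 6 * D"
    using gradient_lipschitz_local[OF y Gy D6 d, of 1] d by auto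
  then have y': "y' \<in> X" and Gy': "norm (G y' - G y) \<le> 6 * D"
    by (auto simp: d_def)
  show "y' \<in> X"
    by (rule y')

  \<comment> \<open>Distance of \<open>y'\<close> to the minimizer\<close>
  have "y' - xs = (1 / (1 + \<alpha>)) *\<^sub>R ((1 + \<alpha>) *\<^sub>R y' - (1 + \<alpha>) *\<^sub>R xs)"
    using \<alpha>(1) by (simp add: scaleR_diff_right)
  \<comment> \<open>Thus \<open>y'\<close> is a convex combination of \<open>u\<close> and a plain
    gradient step from \<open>y\<close>, both within \<open>S\<close> of the minimizer.\<close>
  also have "(1 + \<alpha>) *\<^sub>R y' - (1 + \<alpha>) *\<^sub>R xs = (y - \<gamma> *\<^sub>R G y - xs) + \<alpha> *\<^sub>R (u - xs)"
    unfolding scaled by (simp add: algebra_simps)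
  finally have "norm (y' - xs) = norm ((y - \<gamma> *\<^sub>R G y - xs) + \<alpha> *\<^sub>R (u - xs)) / (1 + \<alpha>)"
    using \<alpha>(1) by simp
  moreover have "norm ((y - \<gamma> *\<^sub>R G y - xs) + \<alpha> *\<^sub>R (u - xs)) \<le> S + \<alpha> * S"
  proof (rule norm_triangle_mono)
    have "l (norm (G y)) \<le> l (8 * D)"
      using Gy D by (intro l_mono) auto
    then have "\<gamma> \<le> 1 / l (norm (G y))"
      unfolding \<gamma>_def using l8 l0 by (intro divide_left_mono mult_pos_pos l_pos) auto
    then show "norm (y - \<gamma> *\<^sub>R G y - xs) \<le> S"
      using order_trans[OF gradient_step_distance[OF y] yS] \<gamma> by simp
    show "norm (\<alpha> *\<^sub>R (u - xs)) \<le> \<alpha> * S"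
      using \<alpha>(1) u by simp
  qed
  ultimately have "norm (y' - xs) \<le> S"
    using \<alpha>(1) by (simp add: divide_le_eq algebra_simps)
  then have "(norm (y' - xs))\<^sup>2 \<le> S\<^sup>2"
    by (intro power_mono) auto
  then show "(norm (y' - xs))\<^sup>2 \<le> 2 * R\<^sup>2"
    by (simp add: S(2))

  \<comment> \<open>Decrease of the energy\<close>
  have coco: "F y' + G y' \<bullet> (y - y') + \<gamma> / 2 * (norm (G y - G y'))\<^sup>2 \<le> F y"
    using cocoercive[OF y y' Gy Gy', of "2 * l 0"] l8 by (simp add: \<gamma>_def)
  have tang: "\<alpha> * (F y' + G y' \<bullet> (xs - y')) \<le> \<alpha> * F xs"
    using above_tangent[OF y' xs] \<alpha>(1) by (intro mult_left_mono) auto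
  \<comment> \<open>The form of \<open>y'\<close> makes the linear terms collapse: the
    \<open>\<gamma>\<close> part cancels the cross term of \<open>sq\<close>, the
    \<open>\<alpha>\<close> part the inner product in \<open>proj\<close>.\<close>
  have "(y - y') + \<alpha> *\<^sub>R (xs - y') = y + \<alpha> *\<^sub>R xs - (1 + \<alpha>) *\<^sub>R y'"
    by (simp add: algebra_simps)
  also have "\<dots> = \<gamma> *\<^sub>R G y - \<alpha> *\<^sub>R (u - xs)"
    unfolding scaled by (simp add: algebra_simps)
  finally have "G y' \<bullet> ((y - y') + \<alpha> *\<^sub>R (xs - y')) = G y' \<bullet> (\<gamma> *\<^sub>R G y - \<alpha> *\<^sub>R (u - xs))"
    by simp
  then have lin: "G y' \<bullet> (y - y') + \<alpha> * (G y' \<bullet> (xs - y'))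
      = \<gamma> * (G y' \<bullet> G y) - \<alpha> * (G y' \<bullet> (u - xs))"
    by (simp only: inner_add_right inner_diff_right inner_scaleR_right)
  have sq: "\<gamma> / 2 * (norm (G y - G y'))\<^sup>2
      = \<gamma> / 2 * (norm (G y))\<^sup>2 - \<gamma> * (G y' \<bullet> G y) + \<gamma> / 2 * (norm (G y'))\<^sup>2"
    unfolding norm_diff_scaleR_squared[of "G y" 1 "G y'", unfolded scaleR_one]
    by (simp add: algebra_simps)

  have "dist u' (closest_point (closure X) xs) \<le> dist (u - (\<alpha> / \<Gamma>) *\<^sub>R G y') xs"
    unfolding u'_def using xs convexX by (intro closest_point_lipschitz convex_closure) auto
  \<comment> \<open>The projection is nonexpansive and fixes the minimizer, so it can only bring
    \<open>u'\<close> closer.\<close>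
  moreover have "closest_point (closure X) xs = xs"
    using xs closure_subset by (intro closest_point_self) blast
  ultimately have "norm (u' - xs) \<le> norm ((u - xs) - (\<alpha> / \<Gamma>) *\<^sub>R G y')"
    by (simp add: dist_norm algebra_simps)
  then have "(norm (u' - xs))\<^sup>2 \<le> (norm ((u - xs) - (\<alpha> / \<Gamma>) *\<^sub>R G y'))\<^sup>2"
    by (intro power_mono) auto
  also have "\<dots> = (norm (u - xs))\<^sup>2 - 2 * (\<alpha> / \<Gamma>) * (G y' \<bullet> (u - xs)) + (\<alpha> / \<Gamma>)\<^sup>2 * (norm (G y'))\<^sup>2"
    by (rule norm_diff_scaleR_squared)
  finally have "\<Gamma> / 2 * (norm (u' - xs))\<^sup>2 \<le> \<Gamma> / 2 * \<dots>"
    using \<Gamma> by (intro mult_left_mono) auto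
  also have "\<dots> = \<Gamma> / 2 * (norm (u - xs))\<^sup>2 - \<alpha> * (G y' \<bullet> (u - xs)) + \<alpha>\<^sup>2 / \<Gamma> / 2 * (norm (G y'))\<^sup>2"
    using \<Gamma>(1) by (simp add: power2_eq_square field_simps)
  \<comment> \<open>The choice of \<open>\<alpha>\<close> matches this term with the
    \<open>norm (G y')\<close> term of \<open>sq\<close>.\<close>
  also have "\<alpha>\<^sup>2 / \<Gamma> = \<gamma>"
    using \<Gamma> by (simp add: \<alpha>(2))
  finally have proj: "\<Gamma> / 2 * (norm (u' - xs))\<^sup>2
      \<le> \<Gamma> / 2 * (norm (u - xs))\<^sup>2 - \<alpha> * (G y' \<bullet> (u - xs)) + \<gamma> / 2 * (norm (G y'))\<^sup>2" .

  have "0 \<le> \<gamma> / 2 * (norm (G y))\<^sup>2"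
    using \<gamma> by simp
  then have "(1 + \<alpha>) * (F y' - F xs) + \<Gamma> / 2 * (norm (u' - xs))\<^sup>2 \<le> \<Gamma> * R\<^sup>2"
    using coco tang lin sq proj energy by (simp only: distrib_left distrib_right right_diff_distrib)
  then have "((1 + \<alpha>) * (F y' - F xs) + \<Gamma> / 2 * (norm (u' - xs))\<^sup>2) / (1 + \<alpha>) \<le> \<Gamma> * R\<^sup>2 / (1 + \<alpha>)"
    using \<alpha>(1) by (intro divide_right_mono) auto
  then show "F y' - F xs + \<Gamma> / (1 + \<alpha>) / 2 * (norm (u' - xs))\<^sup>2 \<le> \<Gamma> / (1 + \<alpha>) * R\<^sup>2"
    using \<alpha>(1) by (simp add: add_divide_distrib ac_simps)
qed

end

section \<open>Extended-valued functions\<close>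

lemma linear_eq_inner:
  fixes D :: "'a::euclidean_space \<Rightarrow> real"
  assumes "linear D"
  shows "D h = h \<bullet> (\<Sum>b\<in>Basis. D b *\<^sub>R b)"
proof -
  have "D h = D (\<Sum>b\<in>Basis. (h \<bullet> b) *\<^sub>R b)"
    by (simp add: euclidean_representation)
  also have "\<dots> = (\<Sum>b\<in>Basis. (h \<bullet> b) * D b)"
    using assms by (simp add: linear_sum linear_cmul)
  finally show ?thesis
    by (simp add: inner_sum_right mult.commute)
qed

text \<open>Justifies the definite description in \<open>grad\<close>: the derivative is represented
  by its coordinates in the basis, and uniqueness follows from that of the derivative.\<close>

lemma GDERIV_grad:
  fixes f :: "'a::euclidean_space \<Rightarrow> ereal"
  assumes "(\<lambda>z. real_of_ereal (f z)) differentiable (at x)"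
  shows "GDERIV (\<lambda>z. real_of_ereal (f z)) x :> grad f x"
proof -
  obtain D where D: "((\<lambda>z. real_of_ereal (f z)) has_derivative D) (at x)"
    using assms by (auto simp: differentiable_def)
  then have "linear D"
    by (rule has_derivative_linear)
  then have "D = (\<lambda>h. h \<bullet> (\<Sum>b\<in>Basis. D b *\<^sub>R b))"
    using linear_eq_inner by blast
  with D have ex: "GDERIV (\<lambda>z. real_of_ereal (f z)) x :> (\<Sum>b\<in>Basis. D b *\<^sub>R b)"
    unfolding gderiv_def by metis
  have unique: "d = d'"
    if "GDERIV (\<lambda>z. real_of_ereal (f z)) x :> d" "GDERIV (\<lambda>z. real_of_ereal (f z)) x :> d'" for d d'
  proof -
    have "(\<lambda>h. h \<bullet> d) = (\<lambda>h. h \<bullet> d')"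
      using that unfolding gderiv_def by (rule has_derivative_unique)
    then have "h \<bullet> d = h \<bullet> d'" for h
      by (rule fun_cong)
    then show ?thesis
      by (metis vector_eq_ldot)
  qed
  show ?thesis
    unfolding grad_def by (rule theI, rule ex, rule unique[OF _ ex])
qed

lemma eff_dom_finite: "f x \<noteq> -\<infinity> \<Longrightarrow> x \<in> eff_dom f \<Longrightarrow> f x = ereal (real_of_ereal (f x))"
  by (cases "f x") (auto simp: eff_dom_def)

lemma smooth_convex_eff_dom:
  fixes f :: "'a::euclidean_space \<Rightarrow> ereal"
  assumes ninf: "\<And>x. f x \<noteq> -\<infinity>" and op: "open (eff_dom f)" and cv: "convex (eff_dom f)"
    and fc: "ereal_convex f" and ls: "l_smooth l f"
  shows "smooth_convex (eff_dom f) (\<lambda>z. real_of_ereal (f z)) (grad f) (hess f) l"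
proof
  let ?X = "eff_dom f" and ?F = "\<lambda>z. real_of_ereal (f z)"
  note fin = eff_dom_finite[of f, OF ninf]
  show "open ?X"
    by (rule op)
  show "convex_on ?X ?F"
  proof (rule convex_onI[OF _ cv])
    fix t :: real and x y
    assume t: "0 < t" "t < 1" and xy: "x \<in> ?X" "y \<in> ?X"
    have z: "(1 - t) *\<^sub>R x + t *\<^sub>R y \<in> ?X"
      using cv xy t by (simp add: convex_alt)
    have "f ((1 - t) *\<^sub>R x + t *\<^sub>R y) \<le> ereal (1 - t) * f x + ereal t * f y"
      using fc t by (simp add: ereal_convex_def)
    then have "ereal (?F ((1 - t) *\<^sub>R x + t *\<^sub>R y))
        \<le> ereal (1 - t) * ereal (?F x) + ereal t * ereal (?F y)"
      by (simp only: fin[OF z, symmetric] fin[OF xy(1), symmetric] fin[OF xy(2), symmetric])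
    then show "?F ((1 - t) *\<^sub>R x + t *\<^sub>R y) \<le> (1 - t) * ?F x + t * ?F y"
      by (simp only: times_ereal.simps plus_ereal.simps ereal_less_eq)
  qed
  show "(?F has_derivative (\<lambda>h. h \<bullet> grad f x)) (at x)" if "x \<in> ?X" for x
    using GDERIV_grad[of f x] ls that by (simp add: gderiv_def l_smooth_def)
  show "(grad f has_derivative hess f x) (at x)" if "x \<in> ?X" for x
    using ls that unfolding l_smooth_def hess_def by (simp flip: frechet_derivative_works)
  show "onorm (hess f x) \<le> l (norm (grad f x))" if "x \<in> ?X" for x
    using ls that by (simp add: l_smooth_def)
  show "closed {x \<in> ?X. ?F x \<le> c}" for c
  proof -
    have "closed (closure ?X \<inter> f -` {..ereal c})"
      using ls unfolding l_smooth_def by (intro continuous_closed_preimage) auto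
    \<comment> \<open>A finite bound on \<open>f\<close> already places a point in the domain, so
      boundary points drop out.\<close>
    also have "closure ?X \<inter> f -` {..ereal c} = {x \<in> ?X. ?F x \<le> c}"
    proof (intro set_eqI iffI)
      fix x assume "x \<in> closure ?X \<inter> f -` {..ereal c}"
      then have le: "f x \<le> ereal c"
        by simp
      then have "f x < \<infinity>"
        by (rule order_le_less_trans) simp
      then have x: "x \<in> ?X"
        by (simp add: eff_dom_def)
      then show "x \<in> {x \<in> ?X. ?F x \<le> c}"
        using le fin[OF x] by (metis (mono_tags, lifting) ereal_less_eq(3) mem_Collect_eq)
    next
      fix x assume x: "x \<in> {x \<in> ?X. ?F x \<le> c}"
      then have "f x \<le> ereal c"
        using fin[of x] by (metis (mono_tags, lifting) ereal_less_eq(3) mem_Collect_eq)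
      then show "x \<in> closure ?X \<inter> f -` {..ereal c}"
        using x closure_subset[of ?X] by auto
    qed
    finally show ?thesis .
  qed
  show "l s \<le> l t" if "0 \<le> s" "s \<le> t" for s t
    using ls that by (auto simp: l_smooth_def monotone_on_def)
  show "0 < l s" if "0 \<le> s" for s
    using ls that by (simp add: l_smooth_def)
qed

text \<open>Termination of the first phase is part of the claim, since it gives the
  \<open>LEAST\<close> in \<open>phase1_output\<close> its meaning.\<close>

theorem theorem3p2:
  fixes f :: "real ^ 'd \<Rightarrow> ereal" and l :: "real \<Rightarrow> real"
    and x0 xs :: "real ^ 'd" and \<delta> Rbar kbar :: real
  assumes "\<And>x. f x \<noteq> -\<infinity>"
    and "open (eff_dom f)" and "convex (eff_dom f)" and "eff_dom f \<noteq> {}"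
    and "ereal_convex f" and "l_smooth l f"
    and "\<And>x. f xs \<le> f x"
    and "x0 \<in> eff_dom f"
    and "strict_mono_on {0..} (\<lambda>s. s\<^sup>2 / (2 * l (4 * s)))"
    and "\<delta> > 0" and "l (8 * sqrt (\<delta> * l 0)) \<le> 2 * l 0"
    and "Rbar > 0" and "norm (x0 - xs) \<le> Rbar"
  defines "kbar \<equiv> max (1 + 1 / 2 * log (3 / 2) (alg_Gamma l \<delta> Rbar 0 / (8 * l 0))) 0"
  shows "(\<exists>j. gd_stop l f xs \<delta> x0 j) \<and>
    (\<forall>k::nat. real k \<ge> kbar \<longrightarrow>
       f (alg_y l f xs \<delta> Rbar x0 (k + 1)) - f xs \<le> ereal (alg_Gamma l \<delta> Rbar (k + 1) * Rbar\<^sup>2) \<and>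
       alg_Gamma l \<delta> Rbar (k + 1) * Rbar\<^sup>2 \<le> 18 * l 0 * Rbar\<^sup>2 / (real k + 1 - kbar)\<^sup>2)"
proof -
  let ?X = "eff_dom f" and ?F = "\<lambda>z. real_of_ereal (f z)"
  let ?\<Gamma> = "alg_Gamma l \<delta> Rbar"
  note fin = eff_dom_finite[of f, OF assms(1)]
  have xs: "xs \<in> ?X"
    using assms(7)[of x0] assms(8) unfolding eff_dom_def by (auto intro: order_le_less_trans)
  interpret smooth_convex ?X ?F "grad f" "hess f" l
    using assms by (intro smooth_convex_eff_dom) auto
  interpret smooth_convex_min ?X ?F "grad f" "hess f" l xs
  proof
    show "?F xs \<le> ?F x" if "x \<in> ?X" for x
      using assms(7)[of x] fin[OF xs] fin[OF that] by (metis ereal_less_eq(3))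
  qed (rule xs)
  have gap: "f x - f xs \<le> ereal c \<longleftrightarrow> ?F x - ?F xs \<le> c" if "x \<in> ?X" for x c
    by (subst fin[OF that], subst fin[OF xs]) simp
  have l0: "0 < l 0"
    by (simp add: l_pos)

  \<comment> \<open>The first phase\<close>
  let ?x = "gd_iter l f x0"
  have start: "?x 0 \<in> ?X"
    using assms(8) by simp
  have step: "?x (Suc j) = ?x j - step_size (?x j) *\<^sub>R grad f (?x j)" for j
    by (simp add: step_size_def gd_step_size_def)
  have inv: "?x j \<in> ?X \<and> norm (?x j - xs) \<le> norm (x0 - xs)" for j
    using gd_invariant[of ?x, OF start step] by simp
  have "\<exists>j. ?F (?x j) - ?F xs \<le> \<delta> / 2"
    using assms(10) by (intro gd_reaches[of ?x, OF start step assms(9)]) simp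
  then have stop: "\<exists>j. gd_stop l f xs \<delta> x0 j"
    using gap inv by (simp add: gd_stop_def)
  define xbar where "xbar = phase1_output l f xs \<delta> x0"
  have xbar: "xbar \<in> ?X" "norm (xbar - xs) \<le> Rbar"
    using inv assms(13) unfolding xbar_def phase1_output_def by (auto intro: order_trans)
  have xbar_gap: "?F xbar - ?F xs \<le> \<delta> / 2"
    using LeastI_ex[OF stop] gap[of xbar] xbar(1)
    by (simp add: gd_stop_def xbar_def phase1_output_def)

  \<comment> \<open>The second phase\<close>
  have \<gamma>: "alg_gamma l = 1 / (2 * l 0)"
    by (rule alg_gamma_def)
  have \<Gamma>_pos: "0 < ?\<Gamma> k" for k
    using assms(10,12) l0 by (induction k) (auto intro!: divide_pos_pos add_pos_nonneg simp: \<gamma>)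
  have \<Gamma>_le: "?\<Gamma> k * Rbar\<^sup>2 \<le> \<delta>" for k
  proof (induction k)
    case 0
    then show ?case
      using assms(12) by simp
  next
    case (Suc k)
    have "?\<Gamma> (Suc k) \<le> ?\<Gamma> k / 1"
      unfolding alg_Gamma.simps using \<Gamma>_pos[of k] l0 by (intro divide_left_mono) (auto simp: \<gamma> add_pos_nonneg)
    then show ?case
      using Suc mult_right_mono[of "?\<Gamma> (Suc k)" "?\<Gamma> k" "Rbar\<^sup>2"] by simp
  qed
  have phase2: "case phase2_iter l f \<delta> Rbar xbar k of (y, u) \<Rightarrow>
      y \<in> ?X \<and> (norm (y - xs))\<^sup>2 \<le> 2 * Rbar\<^sup>2 \<and>
      ?F y - ?F xs + ?\<Gamma> k / 2 * (norm (u - xs))\<^sup>2 \<le> ?\<Gamma> k * Rbar\<^sup>2" for k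
  proof (induction k)
    case 0
    have sq: "(norm (xbar - xs))\<^sup>2 \<le> Rbar\<^sup>2"
      using xbar(2) by (intro power_mono) auto
    \<comment> \<open>The initial energy splits evenly: the gap and this distance term are each at
      most \<open>\<delta> / 2\<close>.\<close>
    have "?\<Gamma> 0 / 2 * (norm (xbar - xs))\<^sup>2 \<le> ?\<Gamma> 0 / 2 * Rbar\<^sup>2"
      using sq \<Gamma>_pos[of 0] by (intro mult_left_mono) auto
    moreover have "?\<Gamma> 0 * Rbar\<^sup>2 = \<delta>"
      using assms(12) by simp
    moreover have "(norm (xbar - xs))\<^sup>2 \<le> 2 * Rbar\<^sup>2"
      using sq by (simp add: order_trans)
    ultimately show ?case
      using xbar(1) xbar_gap by (simp del: alg_Gamma.simps)
  next
    case (Suc k)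
    obtain y u where yu: "phase2_iter l f \<delta> Rbar xbar k = (y, u)"
      by fastforce
    with Suc have "y \<in> ?X" "(norm (y - xs))\<^sup>2 \<le> 2 * Rbar\<^sup>2"
      "?F y - ?F xs + ?\<Gamma> k / 2 * (norm (u - xs))\<^sup>2 \<le> ?\<Gamma> k * Rbar\<^sup>2"
      by auto
    from accelerated_step[OF assms(9-12) \<Gamma>_pos \<Gamma>_le this] show ?case
      by (simp add: yu Let_def alg_alpha_def \<gamma>)
  qed
  have rate: "?\<Gamma> (k + 1) * Rbar\<^sup>2 \<le> 18 * l 0 * Rbar\<^sup>2 / (real k + 1 - kbar)\<^sup>2"
    if k: "kbar \<le> real k" for k
  proof -
    \<comment> \<open>This is the square of \<open>alg_alpha\<close>; the normalization frees the
      recursion of parameters and turns the constant 9 into \<open>18 * l 0\<close>.\<close>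
    define a where "a k = ?\<Gamma> k / (2 * l 0)" for k
    have "a (k + 1) \<le> 9 / (real (k + 1) - kbar)\<^sup>2"
    proof (rule inverse_sqrt_step_rate[of a])
      show "0 < a 0"
        unfolding a_def using \<Gamma>_pos[of 0] l0 by (intro divide_pos_pos) auto
      show "a (Suc k) = a k / (1 + sqrt (a k))" for k
        by (simp add: a_def \<gamma>)
      show "1 + 1 / 2 * log (3 / 2) (a 0 / 4) \<le> kbar"
      proof -
        have eq: "a 0 / 4 = ?\<Gamma> 0 / (8 * l 0)"
          by (simp add: a_def del: alg_Gamma.simps)
        show ?thesis
          unfolding kbar_def eq by (rule max.cobounded1)
      qed
    qed (use k in \<open>auto simp: kbar_def\<close>)
    then have "2 * l 0 * Rbar\<^sup>2 * a (k + 1) \<le> 2 * l 0 * Rbar\<^sup>2 * (9 / (real (k + 1) - kbar)\<^sup>2)"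
      using l0 by (intro mult_left_mono) auto
    then show ?thesis
      using l0 by (simp add: a_def ac_simps del: alg_Gamma.simps)
  qed
  have "f (alg_y l f xs \<delta> Rbar x0 k) - f xs \<le> ereal (?\<Gamma> k * Rbar\<^sup>2)" for k
  proof -
    obtain y u where yu: "phase2_iter l f \<delta> Rbar xbar k = (y, u)"
      by fastforce
    have "0 \<le> ?\<Gamma> k / 2 * (norm (u - xs))\<^sup>2"
      using \<Gamma>_pos[of k] by simp
    then have "y \<in> ?X" "?F y - ?F xs \<le> ?\<Gamma> k * Rbar\<^sup>2"
      using phase2[of k] unfolding yu by auto
    then show ?thesis
      using gap yu by (simp add: alg_y_def xbar_def)
  qed
  then show ?thesis
    using stop rate by blast
qed

end
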